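(* Let $\mathcal{A}$ denote the learned quasi-Newton algorithm defined in the context, with the initial matrix $B_{-1}=0.8\,\gamma_{\mathrm{BB}}^{(0)}\mathbb{I}_n$. Then $\mathcal{A}$ follows the five principles below. (1) (Dimension independence) The algorithm is independent of the dimension $n$, i.e. the number $p$ of learned parameters (the size of $\theta$) and the number $n_i$ of columns of the model input $I_k$ are independent of $n$ and as small as possible (the last clause being an informal design requirement; here $p=216$ and $n_i=3$ for every $n$). For the remaining principles, let $\mathcal{A}(f,x_0,x_{-1},K)=x_K$ denote the output of the algorithm after $K$ iterations, with the same parameter $\theta\in\mathbb{R}^p$ and the same step-size $\gamma>0$ in all runs. For every dimension $n\ge 1$, every lower bounded twice continuously differentiable $f:\mathbb{R}^n\to\mathbb{R}$, all $x_{-1},x_0\in\mathbb{R}^n$ and every $K\in\mathbb{N}$: (2) (Translation equivariance) for every $v\in\mathbb{R}^n$, $$\mathcal{A}\big(f(\cdot-v),\,x_0+v,\,x_{-1}+v,\,K\big)=\mathcal{A}(f,x_0,x_{-1},K)+v;$$ (3) (Permutation equivariance) for every $n\times n$ permutation matrix $P$, $$\mathcal{A}\big(f(P^{-1}\cdot),\,Px_0,\,Px_{-1},\,K\big)=P\,\mathcal{A}(f,x_0,x_{-1},K);$$ (4) (Equivariance to geometric rescaling) for every $\lambda>0$, $$\mathcal{A}\big(f(\lambda^{-1}\cdot),\,\lambda x_0,\,\lambda x_{-1},\,K\big)=\lambda\,\mathcal{A}(f,x_0,x_{-1},K);$$ (5) (Invariance to function rescaling) for every $\lambda>0$, $$\mathcal{A}\big(\lambda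 f,\,x_0,\,x_{-1},\,K\big)=\mathcal{A}(f,x_0,x_{-1},K).$$
   Context: $\mathbb{N}$ is the set of non-negative integers, $\mathbb{I}_n$ is the identity matrix, $\langle\cdot,\cdot\rangle$ and $\|\cdot\|$ are the Euclidean inner product and norm on $\mathbb{R}^n$. **The learned model $\mathcal{M}_\theta$.** The parameter is $\theta=(W_1,W_2,W_3,V_1,V_2,\ell)$ with $W_1\in\mathbb{R}^{6\times 3}$, $W_2\in\mathbb{R}^{12\times 6}$, $W_3\in\mathbb{R}^{3\times 12}$, $V_1\in\mathbb{R}^{12\times 6}$, $V_2\in\mathbb{R}^{1\times 12}$, $\ell\in\mathbb{R}^{1\times 6}$; $p=216$ is the total number of entries, so $\theta$ is identified with an element of $\mathbb{R}^p$. Let $\sigma(t)=\max(t,0)$ (ReLU), applied entrywise. For every $n$, the model $\mathcal{M}_\theta:\mathbb{R}^{n\times n_i}\to\mathbb{R}^n$, with $n_i=3$, maps a matrix $I$ with rows $u_1,\dots,u_n$ (viewed as column vectors in $\mathbb{R}^3$) to $y=(y^{(1)},\dots,y^{(n)})$ as follows: $$h_i=W_3\,\sigma(W_2\,\sigma(W_1u_i)),\qquad \bar h=\frac1n\sum_{i=1}^n h_i,\qquad z_i=\begin{pmatrix}\bar h\\ u_i\end{pmatrix}\in\mathbb{R}^6,\qquad y^{(i)}=V_2\,\sigma(V_1z_i)+\ell z_i .$$ There are no bias terms. **The algorithm.** Inputs: a function $f:\mathbb{R}^n\to\mathbb{R}$, points $x_{-1},x_0\in\mathbb{R}^n$, a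 number of iterations $K$, a step-size $\gamma>0$ (default value $\gamma=1$). Write $d_k=x_k-x_{k-1}$ and $\Delta g_k=\nabla f(x_k)-\nabla f(x_{k-1})$. Initialize $$B_{-1}=0.8\,\gamma_{\mathrm{BB}}^{(0)}\,\mathbb{I}_n,\qquad \gamma_{\mathrm{BB}}^{(0)}=\frac{\langle\Delta g_0,d_0\rangle}{\|\Delta g_0\|^2}.$$ For $k=0,\dots,K-1$: - form the input $I_k=\big(B_{k-1}\Delta g_k,\ d_k,\ -\gamma B_{k-1}\nabla f(x_k)\big)\in\mathbb{R}^{n\times 3}$ (three columns); - compute $y_k=\mathcal{M}_\theta(I_k)\in\mathbb{R}^n$; - with $r_k=d_k-B_{k-1}\Delta g_k$, set $$B_k=B_{k-1}+\frac{1}{\langle\Delta g_k,y_k\rangle}\left[r_ky_k^T+y_kr_k^T-\frac{\langle\Delta g_k,r_k\rangle}{\langle\Delta g_k,y_k\rangle}\,y_ky_k^T\right];$$ - set $x_{k+1}=x_k-\gamma B_k\nabla f(x_k)$. The output is $x_K$. In each run (on a transformed or untransformed problem) the gradients, $\gamma_{\mathrm{BB}}^{(0)}$ and $B_{-1}$ are computed from that run's own function and own points $x_{-1},x_0$. *)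

theory Defs
  imports "HOL-Analysis.Analysis"
begin

definition gradient :: "('a::real_inner \<Rightarrow> real) \<Rightarrow> 'a \<Rightarrow> 'a" where
  "gradient f x = (THE g. GDERIV f x :> g)"

lemma gradient_eqI:
  assumes "GDERIV f x :> g"
  shows "gradient f x = g"
  unfolding gradient_def
proof (rule the_equality)
  show "GDERIV f x :> g" by (rule assms)
next
  fix g' assume "GDERIV f x :> g'"
  then have "(\<lambda>h. inner h g') = (\<lambda>h. inner h g)"
    using assms unfolding gderiv_def by (rule has_derivative_unique)
  then show "g' = g"
    by (metis inner_commute vector_eq_rdot)
qed

text \<open>Twice continuously differentiable; \<open>H x\<close> is the Hessian matrix at \<open>x\<close>.\<close>

definition twice_continuously_differentiable :: "(real^'n \<Rightarrow> real) \<Rightarrow> bool" where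
  "twice_continuously_differentiable f \<longleftrightarrow>
     (\<forall>x. f differentiable (at x)) \<and>
     (\<exists>H :: real^'n \<Rightarrow> real^'n^'n.
        (\<forall>x. (gradient f has_derivative (\<lambda>h. H x *v h)) (at x)) \<and> continuous_on UNIV H)"

definition permutation_matrix :: "real^'n^'n \<Rightarrow> bool" where
  "permutation_matrix P \<longleftrightarrow>
     (\<forall>i j. P $ i $ j \<in> {0, 1}) \<and>
     (\<forall>i. \<exists>!j. P $ i $ j = 1) \<and>
     (\<forall>j. \<exists>!i. P $ i $ j = 1)"

definition ncols :: "'a^'m^'n \<Rightarrow> nat" where
  "ncols A = CARD('m)"

definition outer :: "real^'n \<Rightarrow> real^'m \<Rightarrow> real^'m^'n" where
  "outer x y = (\<chi> i j. x $ i * y $ j)"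

definition relu :: "real^'n \<Rightarrow> real^'n" where
  "relu v = (\<chi> i. max (v $ i) 0)"

text \<open>An \<open>r \<times> c\<close> matrix has type \<open>real^c^r\<close>. The components of a parameter are, in this order,
  \<open>W1\<close>, \<open>W2\<close>, \<open>W3\<close>, \<open>V1\<close>, \<open>V2\<close> and \<open>l\<close>.\<close>

type_synonym qn_param =
  "(real^3^6) \<times> (real^6^12) \<times> (real^12^3) \<times> (real^6^12) \<times> (real^12^1) \<times> (real^6^1)"

definition stack :: "real^3 \<Rightarrow> real^3 \<Rightarrow> real^6" where
  "stack h u = vector [h $ 1, h $ 2, h $ 3, u $ 1, u $ 2, u $ 3]"

text \<open>The numeral index type \<open>6\<close> is \<open>\<int>/6\<int>\<close>, so its index \<open>6\<close> is also called \<open>0\<close>.\<close>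

lemma stack_nth:
  "stack h u $ 1 = h $ 1" "stack h u $ 2 = h $ 2" "stack h u $ 3 = h $ 3"
  "stack h u $ 4 = u $ 1" "stack h u $ 5 = u $ 2" "stack h u $ 6 = u $ 3"
  by (simp_all add: stack_def vector_def)

fun learned_model :: "qn_param \<Rightarrow> real^3^'n \<Rightarrow> real^'n" where
  "learned_model (W1, W2, W3, V1, V2, l) I =
     (let h = (\<lambda>i. W3 *v relu (W2 *v relu (W1 *v (I $ i))));
          hbar = (1 / real CARD('n)) *\<^sub>R (\<Sum>i\<in>UNIV. h i);
          z = (\<lambda>i. stack hbar (I $ i))
      in \<chi> i. (V2 *v relu (V1 *v z i) + l *v z i) $ 1)"

text \<open>Before iteration \<open>k\<close>, the state of the algorithm is the triple consisting of
  \<open>x\<^bsub>k-1\<^esub>\<close>, \<open>x\<^bsub>k\<^esub>\<close> and \<open>B\<^bsub>k-1\<^esub>\<close>. All quotients are totalized by \<open>a / 0 = 0\<close>,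
  so the algorithm has an output even if a denominator vanishes.\<close>

type_synonym 'n qn_state = "(real^'n) \<times> (real^'n) \<times> (real^'n^'n)"

definition bb_stepsize :: "(real^'n \<Rightarrow> real) \<Rightarrow> real^'n \<Rightarrow> real^'n \<Rightarrow> real" where
  "bb_stepsize f x0 xm1 =
     (let d = x0 - xm1; dg = gradient f x0 - gradient f xm1
      in inner dg d / (norm dg)\<^sup>2)"

definition qn_init :: "(real^'n \<Rightarrow> real) \<Rightarrow> real^'n \<Rightarrow> real^'n \<Rightarrow> 'n qn_state" where
  "qn_init f x0 xm1 = (xm1, x0, (0.8 * bb_stepsize f x0 xm1) *\<^sub>R mat 1)"

fun model_input :: "real \<Rightarrow> (real^'n \<Rightarrow> real) \<Rightarrow> 'n qn_state \<Rightarrow> real^3^'n" where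
  "model_input \<gamma> f (xprev, x, B) =
     (let d = x - xprev; dg = gradient f x - gradient f xprev
      in \<chi> i. vector [(B *v dg) $ i, d $ i, (- (\<gamma> *\<^sub>R (B *v gradient f x))) $ i])"

fun qn_step :: "qn_param \<Rightarrow> real \<Rightarrow> (real^'n \<Rightarrow> real) \<Rightarrow> 'n qn_state \<Rightarrow> 'n qn_state" where
  "qn_step \<theta> \<gamma> f (xprev, x, B) =
     (let d = x - xprev;
          dg = gradient f x - gradient f xprev;
          y = learned_model \<theta> (model_input \<gamma> f (xprev, x, B));
          r = d - B *v dg;
          B' = B + (1 / inner dg y) *\<^sub>R
                 (outer r y + outer y r - (inner dg r / inner dg y) *\<^sub>R outer y y)
      in (x, x - \<gamma> *\<^sub>R (B' *v gradient f x), B'))"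

definition qn_iterate ::
  "qn_param \<Rightarrow> real \<Rightarrow> (real^'n \<Rightarrow> real) \<Rightarrow> real^'n \<Rightarrow> real^'n \<Rightarrow> nat \<Rightarrow> 'n qn_state" where
  "qn_iterate \<theta> \<gamma> f x0 xm1 k = (qn_step \<theta> \<gamma> f ^^ k) (qn_init f x0 xm1)"

definition qn_algorithm ::
  "qn_param \<Rightarrow> real \<Rightarrow> (real^'n \<Rightarrow> real) \<Rightarrow> real^'n \<Rightarrow> real^'n \<Rightarrow> nat \<Rightarrow> real^'n" where
  "qn_algorithm \<theta> \<gamma> f x0 xm1 K = fst (snd (qn_iterate \<theta> \<gamma> f x0 xm1 K))"

end

theory Submission
  imports Defs
begin

text \<open>Write \<open>T x = a Q x + v\<close> with \<open>Q\<close> a permutation matrix and \<open>a > 0\<close>, and let \<open>F (T x) = c f x\<close>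
  with \<open>c > 0\<close>; the principles (2)--(5) are all of this form. Then \<open>\<nabla>F (T x) = (c/a) Q \<nabla>f x\<close>.
  By induction the run on \<open>F\<close> has the iterates \<open>T x\<^bsub>k\<^esub>\<close> and the matrices \<open>(a\<^sup>2/c) Q B\<^bsub>k\<^esub> Q\<^sup>T\<close>:
  the Barzilai--Borwein step-size scales by \<open>a\<^sup>2/c\<close>, the model input becomes \<open>a Q I\<^bsub>k\<^esub>\<close>, and the model,
  having no biases and acting identically on all rows, is positively homogeneous and
  permutation equivariant, so that \<open>y\<^bsub>k\<^esub>\<close> becomes \<open>a Q y\<^bsub>k\<^esub>\<close>. The powers of \<open>a\<close> and \<open>c\<close>
  then match in the update of \<open>B\<^bsub>k\<^esub>\<close>.\<close>

section \<open>Permuting the coordinates of vectors and matrices\<close>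

definition permute_vec :: "('n \<Rightarrow> 'n) \<Rightarrow> 'a^'n \<Rightarrow> 'a^'n" where
  "permute_vec p x = (\<chi> i. x $ p i)"

text \<open>This is \<open>Q A Q^T\<close> for the permutation matrix \<open>Q\<close> with
  \<open>Q x = permute_vec p x\<close>.\<close>

definition permute_mat :: "('n \<Rightarrow> 'n) \<Rightarrow> 'a^'n^'n \<Rightarrow> 'a^'n^'n" where
  "permute_mat p A = (\<chi> i j. A $ p i $ p j)"

lemma permute_vec_nth [simp]: "permute_vec p x $ i = x $ p i"
  by (simp add: permute_vec_def)

lemma permute_mat_nth [simp]: "permute_mat p A $ i $ j = A $ p i $ p j"
  by (simp add: permute_mat_def)

lemma permute_vec_id [simp]: "permute_vec id x = x"
  by (simp add: vec_eq_iff)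

lemma permute_vec_comp: "permute_vec p (permute_vec q x) = permute_vec (q \<circ> p) x"
  by (simp add: vec_eq_iff)

lemma permute_vec_diff: "permute_vec p (x - y) = permute_vec p x - permute_vec p y"
  for x :: "real^'n"
  by (simp add: vec_eq_iff)

lemma permute_vec_scaleR: "permute_vec p (r *\<^sub>R x) = r *\<^sub>R permute_vec p x"
  for x :: "real^'n"
  by (simp add: vec_eq_iff)

lemma bounded_linear_permute_vec: "bounded_linear (permute_vec p :: real^'n \<Rightarrow> real^'n)"
  by (intro linear_conv_bounded_linear[THEN iffD1] linearI) (simp_all add: vec_eq_iff)

lemma inner_permute_vec:
  fixes x y :: "real^'n"
  assumes "bij p"
  shows "inner (permute_vec p x) (permute_vec p y) = inner x y"
  unfolding inner_vec_def
  using sum.reindex_bij_betw[OF assms, of "\<lambda>i. x $ i \<bullet> y $ i"] by simp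

lemma norm_permute_vec: "bij p \<Longrightarrow> norm (permute_vec p x) = norm x"
  for x :: "real^'n"
  by (simp add: norm_eq_sqrt_inner inner_permute_vec)

text \<open>\<open>Q\<close> is orthogonal, so \<open>(Q A Q^T) (Q x) = Q (A x)\<close>; in
  coordinates, the sum over the columns is reindexed along \<open>p\<close>.\<close>

lemma permute_mat_mult_vec:
  fixes x :: "real^'n"
  assumes "bij p"
  shows "permute_mat p A *v permute_vec p x = permute_vec p (A *v x)"
proof -
  have "(\<Sum>j\<in>UNIV. A $ p i $ p j * x $ p j) = (\<Sum>j\<in>UNIV. A $ p i $ j * x $ j)" for i
    using sum.reindex_bij_betw[OF assms, of "\<lambda>j. A $ p i $ j * x $ j"] by simp
  then show ?thesis
    by (simp add: vec_eq_iff matrix_vector_mult_def)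
qed

lemma permute_mat_one:
  assumes "bij p"
  shows "permute_mat p (mat 1) = (mat 1 :: 'a::{zero,one}^'n^'n)"
  using assms by (auto simp: vec_eq_iff mat_def dest: bij_is_inj injD)

lemma permute_mat_scaleR: "permute_mat p (r *\<^sub>R A) = r *\<^sub>R permute_mat p A"
  for A :: "real^'n^'n"
  by (simp add: vec_eq_iff)

lemma permutation_matrix_eq_permute_vec:
  assumes "permutation_matrix (P :: real^'n^'n)"
  obtains p where "bij p" "\<And>x. P *v x = permute_vec p x"
proof -
  have rows: "\<exists>!j. P $ i $ j = 1" and cols: "\<exists>!i. P $ i $ j = 1"
    and entries: "P $ i $ j \<in> {0, 1}" for i j
    using assms unfolding permutation_matrix_def by blast+
  \<comment> \<open>Row \<open>i\<close> has its only 1 in column \<open>p i\<close>; that each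
    column has exactly one 1 will make \<open>p\<close> bijective.\<close>
  define p where "p i = (THE j. P $ i $ j = 1)" for i
  have "P $ i $ p i = 1" for i
    unfolding p_def by (rule theI'[OF rows])
  then have p_iff: "P $ i $ j = 1 \<longleftrightarrow> j = p i" for i j
    using rows[of i] by blast
  have nth: "P $ i $ j = (if j = p i then 1 else 0)" for i j
    using p_iff[of i j] entries[of i j] by auto
  have "bij p"
    using cols unfolding p_iff bij_iff by metis
  moreover have "P *v x = permute_vec p x" for x
    by (simp add: vec_eq_iff matrix_vector_mult_def nth if_distrib[of "\<lambda>r. r * _"] cong: if_cong)
  ultimately show thesis by (rule that)
qed

section \<open>Homogeneity and equivariance of the building blocks of an iteration\<close>

lemma outer_permute_vec: "outer (permute_vec p x) (permute_vec p y) = permute_mat p (outer x y)"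
  by (simp add: vec_eq_iff outer_def)

lemma outer_scaleR: "outer (r *\<^sub>R x) (s *\<^sub>R y) = (r * s) *\<^sub>R outer x y"
  by (simp add: vec_eq_iff outer_def)

lemma relu_scaleR:
  assumes "0 \<le> a"
  shows "relu (a *\<^sub>R x) = a *\<^sub>R relu x"
  using assms by (simp add: vec_eq_iff relu_def max_mult_distrib_left)

text \<open>\<open>vector\<close> folds pointwise updates over the zero function; scaling commutes
  with each update and fixes zero.\<close>

lemma scaleR_vector: "a *\<^sub>R vector xs = (vector (map ((*) a) xs) :: real^'n::{finite,one,plus})"
proof -
  let ?F = "\<lambda>x f n. fun_upd (f (n + 1)) n x"
  \<comment> \<open>The tail of the list is placed from index \<open>k + 1\<close> on, so the
    induction needs an arbitrary start index in place of 1.\<close>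
  have "foldr ?F (map ((*) a) xs) (\<lambda>n x. 0) k i = a * foldr ?F xs (\<lambda>n x. 0) k i"
    for k i :: 'n
    by (induction xs arbitrary: k) simp_all
  then show ?thesis
    by (simp add: vec_eq_iff vector_def)
qed

lemma stack_scaleR: "stack (a *\<^sub>R h) (a *\<^sub>R u) = a *\<^sub>R stack h u"
  by (simp add: stack_def scaleR_vector)

lemma learned_model_equivariant:
  fixes I :: "real^3^'n"
  assumes "bij p" "0 \<le> a"
  shows "learned_model \<theta> (a *\<^sub>R permute_vec p I) = a *\<^sub>R permute_vec p (learned_model \<theta> I)"
proof -
  obtain W1 W2 W3 V1 V2 l where \<theta>: "\<theta> = (W1, W2, W3, V1, V2, l)"
    by (metis prod_cases6)
  define h where "h u = W3 *v relu (W2 *v relu (W1 *v u))" for u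
  have h: "h (a *\<^sub>R u) = a *\<^sub>R h u" for u
    using assms(2) by (simp add: h_def relu_scaleR matrix_vector_mult_scaleR)
  \<comment> \<open>The rows interact only through this sum. It ignores their order, so the mean is
    scaled by \<open>a\<close> but not permuted.\<close>
  have "(\<Sum>i\<in>UNIV. h ((a *\<^sub>R permute_vec p I) $ i)) = a *\<^sub>R (\<Sum>i\<in>UNIV. h (I $ i))"
    using sum.reindex_bij_betw[OF assms(1), of "\<lambda>i. h (I $ i)"]
    by (simp add: h scaleR_sum_right[symmetric])
  then have z: "stack ((1 / real CARD('n)) *\<^sub>R (\<Sum>i\<in>UNIV. h ((a *\<^sub>R permute_vec p I) $ i)))
      ((a *\<^sub>R permute_vec p I) $ i) =
    a *\<^sub>R stack ((1 / real CARD('n)) *\<^sub>R (\<Sum>i\<in>UNIV. h (I $ i))) (I $ p i)" for i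
    by (simp only: scaleR_left_commute[of _ a] stack_scaleR vector_scaleR_component
        permute_vec_nth)
  have "V2 *v relu (V1 *v (a *\<^sub>R u)) + l *v (a *\<^sub>R u) =
      a *\<^sub>R (V2 *v relu (V1 *v u) + l *v u)" for u
    using assms(2) by (simp add: matrix_vector_mult_scaleR relu_scaleR scaleR_add_right)
  then show ?thesis
    unfolding \<theta> learned_model.simps Let_def h_def[symmetric] z
    by (simp only: vec_eq_iff vec_lambda_beta vector_scaleR_component permute_vec_nth simp_thms)
qed

lemma GDERIV_gradient:
  fixes f :: "real^'n \<Rightarrow> real"
  assumes "f differentiable (at x)"
  shows "GDERIV f x :> gradient f x"
proof -
  obtain f' where f': "(f has_derivative f') (at x)"
    using assms unfolding differentiable_def by blast
  then have "linear f'"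
    by (rule has_derivative_linear)
  \<comment> \<open>Riesz representation by the adjoint:
    \<open>f' h = inner (f' h) 1 = inner h (adjoint f' 1)\<close>.\<close>
  then have "f' = (\<lambda>h. inner h (adjoint f' 1))"
    using adjoint_works[of f' _ 1] by auto
  then obtain g where "f' = (\<lambda>h. inner h g)"
    by (rule that)
  then have "GDERIV f x :> g"
    using f' by (simp add: gderiv_def)
  then show ?thesis
    by (simp add: gradient_eqI)
qed

section \<open>Runs of the algorithm on two similar problems\<close>

locale similar_problems =
  fixes f F :: "real^'n \<Rightarrow> real" and p :: "'n \<Rightarrow> 'n" and a c :: real and v :: "real^'n"
  assumes bij_p: "bij p"
    and a_pos: "0 < a" and c_pos: "0 < c"
    and differentiable: "f differentiable (at x)"
    and F_eq: "F (a *\<^sub>R permute_vec p x + v) = c * f x"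
begin

definition transform :: "real^'n \<Rightarrow> real^'n" where
  "transform x = a *\<^sub>R permute_vec p x + v"

text \<open>Inverse Hessians transform in this way: if \<open>f\<close> has an invertible Hessian
  \<open>H\<close> at \<open>x\<close>, then \<open>F\<close> has the Hessian
  \<open>(c/a^2) Q H Q^T\<close> at \<open>transform x\<close>. The matrices of a quasi-Newton
  method play the role of the inverse.\<close>

definition transform_mat :: "real^'n^'n \<Rightarrow> real^'n^'n" where
  "transform_mat B = (a\<^sup>2 / c) *\<^sub>R permute_mat p B"

fun transform_state :: "'n qn_state \<Rightarrow> 'n qn_state" where
  "transform_state (xprev, x, B) = (transform xprev, transform x, transform_mat B)"

lemma gradient_transform: "gradient F (transform x) = (c / a) *\<^sub>R permute_vec p (gradient f x)"
proof (rule gradient_eqI)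
  define q where "q = inv p"
  \<comment> \<open>\<open>S\<close> is the inverse of \<open>transform\<close>, so that the chain
    rule applies to \<open>F\<close> written as \<open>c\<close> times \<open>f\<close> after
    \<open>S\<close>.\<close>
  define S where "S y = permute_vec q ((1 / a) *\<^sub>R (y - v))" for y :: "real^'n"
  have pq: "p \<circ> q = id" "q \<circ> p = id"
    using bij_p by (simp_all add: q_def surj_iff[symmetric] bij_is_surj bij_is_inj)
  have S_transform: "S (transform x) = x"
    using a_pos by (simp add: S_def transform_def permute_vec_comp pq)
  have transform_S: "transform (S y) = y" for y
    using a_pos by (simp add: S_def transform_def permute_vec_scaleR permute_vec_comp pq)
  \<comment> \<open>As \<open>transform\<close> is onto, \<open>F_eq\<close> determines
    \<open>F\<close> everywhere.\<close>
  have F: "F = (\<lambda>y. c * f (S y))"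
    using F_eq transform_S unfolding transform_def by metis
  have dS: "(S has_derivative (\<lambda>h. permute_vec q ((1 / a) *\<^sub>R h))) (at (transform x))"
    unfolding S_def
    by (rule bounded_linear.has_derivative[OF bounded_linear_permute_vec])
      (auto intro!: derivative_eq_intros)
  have "(f has_derivative (\<lambda>h. inner h (gradient f x))) (at (S (transform x)))"
    using GDERIV_gradient[OF differentiable] unfolding gderiv_def S_transform .
  from has_derivative_mult_right[OF has_derivative_compose[OF dS this], of c]
  have "(F has_derivative (\<lambda>h. c * inner (permute_vec q ((1 / a) *\<^sub>R h)) (gradient f x)))
      (at (transform x))"
    unfolding F .
  \<comment> \<open>The adjoint of a permutation is its inverse; this moves the permutation from the
    direction \<open>h\<close> to the gradient.\<close>
  moreover have "inner (permute_vec q h) g = inner h (permute_vec p g)" for h g :: "real^'n"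
    using inner_permute_vec[OF bij_p, of "permute_vec q h" g] by (simp add: permute_vec_comp pq)
  ultimately show "GDERIV F (transform x) :> (c / a) *\<^sub>R permute_vec p (gradient f x)"
    unfolding gderiv_def by (simp add: permute_vec_scaleR)
qed

lemma transform_diff: "transform x - transform y = a *\<^sub>R permute_vec p (x - y)"
  by (simp add: transform_def permute_vec_diff scaleR_diff_right)

lemma gradient_transform_diff:
  "gradient F (transform x) - gradient F (transform y) =
    (c / a) *\<^sub>R permute_vec p (gradient f x - gradient f y)"
  by (simp add: gradient_transform permute_vec_diff scaleR_diff_right)

text \<open>The factors multiply to \<open>(a^2/c) (c/a) = a\<close>: a matrix applied to a gradient
  transforms like a difference of points.\<close>

lemma transform_mat_mult_vec:
  "transform_mat B *v ((c / a) *\<^sub>R permute_vec p g) = a *\<^sub>R permute_vec p (B *v g)"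
  using a_pos c_pos
  by (simp add: transform_mat_def scaleR_matrix_vector_assoc[symmetric] matrix_vector_mult_scaleR
      permute_mat_mult_vec[OF bij_p] power2_eq_square)

lemma inner_transform:
  "inner ((c / a) *\<^sub>R permute_vec p g) (a *\<^sub>R permute_vec p x) = c * inner g x"
  for g x :: "real^'n"
  using a_pos by (simp add: inner_permute_vec[OF bij_p])

text \<open>The numerator gains the factor \<open>c\<close> and the denominator
  \<open>(c/a)^2\<close>.\<close>

lemma bb_stepsize_transform:
  "bb_stepsize F (transform x0) (transform xm1) = (a\<^sup>2 / c) * bb_stepsize f x0 xm1"
  using a_pos c_pos
  unfolding bb_stepsize_def Let_def gradient_transform_diff transform_diff inner_transform
  by (simp add: norm_permute_vec[OF bij_p] power2_eq_square mult_ac)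

text \<open>Since \<open>Q Q^T\<close> is the identity, a multiple of the identity changes only by
  its factor.\<close>

lemma qn_init_transform:
  "qn_init F (transform x0) (transform xm1) = transform_state (qn_init f x0 xm1)"
  by (simp add: qn_init_def bb_stepsize_transform transform_mat_def permute_mat_scaleR
      permute_mat_one[OF bij_p] mult.left_commute)

text \<open>One factor \<open>a\<close> serves all three columns: \<open>d\<close> is a difference
  of points, and the other two are matrices applied to gradients.\<close>

lemma model_input_transform:
  "model_input \<gamma> F (transform_state s) = a *\<^sub>R permute_vec p (model_input \<gamma> f s)"
proof -
  obtain xprev x B where s: "s = (xprev, x, B)"
    by (metis prod_cases3)
  show ?thesis
    unfolding s transform_state.simps model_input.simps Let_def gradient_transform_diff
      transform_diff
    unfolding gradient_transform transform_mat_mult_vec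
    by (simp add: vec_eq_iff forall_3)
qed

text \<open>Each outer product gains \<open>a^2\<close> and the leading quotient \<open>1/c\<close>,
  while \<open>c\<close> cancels in the inner ratio; the correction thus scales exactly like
  \<open>B\<close>.\<close>

lemma transform_mat_rank_two_update:
  fixes dg r y :: "real^'n"
  shows "transform_mat B + (1 / (c * inner dg y)) *\<^sub>R
      (outer (a *\<^sub>R permute_vec p r) (a *\<^sub>R permute_vec p y) +
       outer (a *\<^sub>R permute_vec p y) (a *\<^sub>R permute_vec p r) -
       ((c * inner dg r) / (c * inner dg y)) *\<^sub>R
         outer (a *\<^sub>R permute_vec p y) (a *\<^sub>R permute_vec p y)) =
    transform_mat (B + (1 / inner dg y) *\<^sub>R
      (outer r y + outer y r - (inner dg r / inner dg y) *\<^sub>R outer y y))"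
proof -
  have key: "(a\<^sup>2 / c) * b + (t / c) * (a * a * m + a * a * n - u * (a * a * q)) =
      (a\<^sup>2 / c) * (b + t * (m + n - u * q))" for b t m n u q :: real
    using c_pos by (simp add: field_simps power2_eq_square)
  \<comment> \<open>Both identities persist when \<open>inner dg y = 0\<close>: as \<open>c\<close>
    is nonzero, all the quotients are then 0.\<close>
  have coeffs: "1 / (c * inner dg y) = (1 / inner dg y) / c"
    "(c * inner dg r) / (c * inner dg y) = inner dg r / inner dg y"
    using c_pos by simp_all
  show ?thesis
    unfolding coeffs outer_scaleR outer_permute_vec transform_mat_def
    by (simp only: vec_eq_iff vector_add_component vector_minus_component vector_scaleR_component
        permute_mat_nth real_scaleR_def key simp_thms)
qed

lemma qn_step_transform:
  "qn_step \<theta> \<gamma> F (transform_state s) = transform_state (qn_step \<theta> \<gamma> f s)"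
proof -
  obtain xprev x B where s: "s = (xprev, x, B)"
    by (metis prod_cases3)
  define dg where "dg = gradient f x - gradient f xprev"
  define y where "y = learned_model \<theta> (model_input \<gamma> f s)"
  define r where "r = x - xprev - B *v dg"
  define B' where "B' = B + (1 / inner dg y) *\<^sub>R
    (outer r y + outer y r - (inner dg r / inner dg y) *\<^sub>R outer y y)"
  have y: "learned_model \<theta> (model_input \<gamma> F (transform_state s)) = a *\<^sub>R permute_vec p y"
    using a_pos by (simp add: y_def model_input_transform learned_model_equivariant[OF bij_p])
  have r: "transform x - transform xprev -
      transform_mat B *v ((c / a) *\<^sub>R permute_vec p dg) = a *\<^sub>R permute_vec p r"
    unfolding transform_mat_mult_vec transform_diff r_def
    by (simp add: permute_vec_diff scaleR_diff_right)
  have step: "qn_step \<theta> \<gamma> f s = (x, x - \<gamma> *\<^sub>R (B' *v gradient f x), B')"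
    by (simp only: s qn_step.simps Let_def B'_def y_def r_def dg_def)
  have "qn_step \<theta> \<gamma> F (transform_state s) =
      (transform x, transform x - \<gamma> *\<^sub>R (transform_mat B' *v gradient F (transform x)),
       transform_mat B')"
    using y
    unfolding s transform_state.simps qn_step.simps Let_def
    by (simp only: r gradient_transform_diff[of x xprev, folded dg_def] inner_transform
        transform_mat_rank_two_update B'_def)
  \<comment> \<open>The subtracted step transforms without \<open>v\<close>, so the translation
    enters only once, through \<open>transform x\<close>.\<close>
  also have "\<dots> = transform_state (qn_step \<theta> \<gamma> f s)"
    unfolding step transform_state.simps gradient_transform transform_mat_mult_vec
    by (simp add: transform_def permute_vec_diff permute_vec_scaleR scaleR_diff_right
        scaleR_left_commute)
  finally show ?thesis .
qed

theorem qn_algorithm_transform: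
  "qn_algorithm \<theta> \<gamma> F (a *\<^sub>R permute_vec p x0 + v) (a *\<^sub>R permute_vec p xm1 + v) K =
    a *\<^sub>R permute_vec p (qn_algorithm \<theta> \<gamma> f x0 xm1 K) + v"
proof -
  have "qn_iterate \<theta> \<gamma> F (transform x0) (transform xm1) K =
      transform_state (qn_iterate \<theta> \<gamma> f x0 xm1 K)"
    unfolding qn_iterate_def
    by (induction K) (simp_all add: qn_init_transform qn_step_transform)
  moreover have "fst (snd (transform_state s)) = transform (fst (snd s))" for s
    by (cases s rule: transform_state.cases) simp
  ultimately show ?thesis
    unfolding qn_algorithm_def by (simp only: flip: transform_def)
qed

end

section \<open>The five principles, with (2)-(5) as special cases of
  \<open>qn_algorithm_transform\<close>\<close>

theorem theorem1:
  fixes \<theta> :: qn_param and \<gamma> :: real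
  assumes "\<gamma> > 0"
  shows
    "(DIM(qn_param) = 216 \<and>
      (\<forall>(f :: real^'n \<Rightarrow> real) x0 xm1 k. ncols (model_input \<gamma> f (qn_iterate \<theta> \<gamma> f x0 xm1 k)) = 3)) \<and>
     (\<forall>(f :: real^'n \<Rightarrow> real) x0 xm1 K.
        bdd_below (range f) \<longrightarrow> twice_continuously_differentiable f \<longrightarrow>
        (\<forall>v. qn_algorithm \<theta> \<gamma> (\<lambda>x. f (x - v)) (x0 + v) (xm1 + v) K =
              qn_algorithm \<theta> \<gamma> f x0 xm1 K + v) \<and>
        (\<forall>P. permutation_matrix P \<longrightarrow>
              qn_algorithm \<theta> \<gamma> (\<lambda>x. f (matrix_inv P *v x)) (P *v x0) (P *v xm1) K =
              P *v qn_algorithm \<theta> \<gamma> f x0 xm1 K) \<and>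
        (\<forall>c>0. qn_algorithm \<theta> \<gamma> (\<lambda>x. f (inverse c *\<^sub>R x)) (c *\<^sub>R x0) (c *\<^sub>R xm1) K =
              c *\<^sub>R qn_algorithm \<theta> \<gamma> f x0 xm1 K) \<and>
        (\<forall>c>0. qn_algorithm \<theta> \<gamma> (\<lambda>x. c * f x) x0 xm1 K =
              qn_algorithm \<theta> \<gamma> f x0 xm1 K))"
proof (intro conjI allI impI)
  \<comment> \<open>The six matrices contribute 18 + 72 + 36 + 72 + 12 + 6 entries.\<close>
  show "DIM(qn_param) = 216"
    by simp
  show "ncols (model_input \<gamma> f (qn_iterate \<theta> \<gamma> f x0 xm1 k)) = 3"
    for f :: "real^'n \<Rightarrow> real" and x0 xm1 k
    by (simp add: ncols_def)
next
  fix f :: "real^'n \<Rightarrow> real" and x0 xm1 :: "real^'n" and K :: nat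
  assume "twice_continuously_differentiable f"
  then have diff: "f differentiable (at x)" for x
    unfolding twice_continuously_differentiable_def by blast
  show "qn_algorithm \<theta> \<gamma> (\<lambda>x. f (x - v)) (x0 + v) (xm1 + v) K =
      qn_algorithm \<theta> \<gamma> f x0 xm1 K + v" for v
  proof -
    interpret similar_problems f "\<lambda>x. f (x - v)" id 1 1 v
      by unfold_locales (simp_all add: diff)
    show ?thesis
      using qn_algorithm_transform by simp
  qed
  show "qn_algorithm \<theta> \<gamma> (\<lambda>x. f (matrix_inv P *v x)) (P *v x0) (P *v xm1) K =
      P *v qn_algorithm \<theta> \<gamma> f x0 xm1 K" if "permutation_matrix P" for P
  proof -
    obtain p where p: "bij p" "\<And>x. P *v x = permute_vec p x"
      using permutation_matrix_eq_permute_vec[OF \<open>permutation_matrix P\<close>] by blast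
    \<comment> \<open>\<open>matrix_inv\<close> is a choice that is meaningful only for invertible
      matrices; injectivity of the square matrix \<open>P\<close> provides invertibility.\<close>
    have "inj ((*v) P)"
    proof (rule injI)
      fix x y assume "P *v x = P *v y"
      then have "x $ p i = y $ p i" for i
        unfolding p(2) by (metis permute_vec_nth)
      then show "x = y"
        using p(1) by (metis bij_pointE vec_eq_iff)
    qed
    then have "invertible P"
      by (simp add: invertible_left_inverse matrix_left_invertible_injective)
    then have "matrix_inv P ** P = mat 1"
      unfolding invertible_def matrix_inv_def by (rule someI2_ex) simp
    then have "matrix_inv P *v permute_vec p x = x" for x
      by (simp add: matrix_vector_mul_assoc flip: p(2))
    then interpret similar_problems f "\<lambda>x. f (matrix_inv P *v x)" p 1 1 0
      by unfold_locales (simp_all add: diff p(1))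
    show ?thesis
      using qn_algorithm_transform by (simp add: p(2))
  qed
  show "qn_algorithm \<theta> \<gamma> (\<lambda>x. f (inverse c *\<^sub>R x)) (c *\<^sub>R x0) (c *\<^sub>R xm1) K =
      c *\<^sub>R qn_algorithm \<theta> \<gamma> f x0 xm1 K" if "c > 0" for c
  proof -
    \<comment> \<open>The geometric factor, here named \<open>c\<close>, instantiates the locale
      parameter \<open>a\<close>; the function factor is 1.\<close>
    interpret similar_problems f "\<lambda>x. f (inverse c *\<^sub>R x)" id c 1 0
      using that by unfold_locales (simp_all add: diff)
    show ?thesis
      using qn_algorithm_transform by simp
  qed
  show "qn_algorithm \<theta> \<gamma> (\<lambda>x. c * f x) x0 xm1 K =
      qn_algorithm \<theta> \<gamma> f x0 xm1 K" if "c > 0" for c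
  proof -
    \<comment> \<open>Now the points stay fixed and only the function factor differs from the
      trivial choice.\<close>
    interpret similar_problems f "\<lambda>x. c * f x" id 1 c 0
      using that by unfold_locales (simp_all add: diff)
    show ?thesis
      using qn_algorithm_transform by simp
  qed
qed

end
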